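(* Let $K$ be a field of characteristic zero, $x=(x_1,\dots,x_n)$, and let $G\in K[x]^n$ be a Keller map such that $\mathcal{J}G$ is symmetric. Let $i$ be an index and $d$ a positive integer such that $\frac{\partial}{\partial x_i}G_i^{(1)}\neq 0$ and $G_i^{(1)}\mid G_i^{(k)}$ for all $k\in\{1,2,\dots,d-1\}$, where $G_i^{(k)}$ denotes the homogeneous part of degree $k$ of $G_i$. If for some $c\in K$ the polynomial $G_i-c$ has a divisor $g$ with $\deg g<d$ and $g(0)=0$, then $\deg G_i=1$.
   Context: A Keller map is a polynomial map $G\in K[x]^n$ with $\det\mathcal{J}G\in K^{*}$, $\mathcal{J}$ the Jacobian matrix. *)

theory Defs
  imports "HOL-Analysis.Analysis" "HOL-Library.Poly_Mapping"
begin

text \<open>Multivariate polynomials over 'a in the variables indexed by 'v: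
  finitely supported maps from monomials (exponent vectors) to coefficients.
  Ring operations are those of Poly_Mapping (convolution product).\<close>
type_synonym ('v, 'a) mpoly = "('v \<Rightarrow>\<^sub>0 nat) \<Rightarrow>\<^sub>0 'a"

definition mconst :: "'a::zero \<Rightarrow> ('v, 'a) mpoly" where
  "mconst c = Poly_Mapping.single 0 c"

definition mon_deg :: "('v \<Rightarrow>\<^sub>0 nat) \<Rightarrow> nat" where
  "mon_deg m = (\<Sum>v\<in>Poly_Mapping.keys m. Poly_Mapping.lookup m v)"

text \<open>Total degree of a polynomial (0 for the zero polynomial).\<close>
definition total_deg :: "('v, 'a::zero) mpoly \<Rightarrow> nat" where
  "total_deg p = Max (insert 0 (mon_deg ` Poly_Mapping.keys p))"

definition hom_part :: "nat \<Rightarrow> ('v, 'a::comm_monoid_add) mpoly \<Rightarrow> ('v, 'a) mpoly" where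
  "hom_part k p = (\<Sum>m\<in>{m \<in> Poly_Mapping.keys p. mon_deg m = k}. Poly_Mapping.single m (Poly_Mapping.lookup p m))"

definition pdiff :: "'v \<Rightarrow> ('v, 'a::comm_ring_1) mpoly \<Rightarrow> ('v, 'a) mpoly" where
  "pdiff v p = (\<Sum>m\<in>Poly_Mapping.keys p.
      Poly_Mapping.single (m - Poly_Mapping.single v 1) (of_nat (Poly_Mapping.lookup m v) * Poly_Mapping.lookup p m))"

definition eval_zero :: "('v, 'a::zero) mpoly \<Rightarrow> 'a" where
  "eval_zero p = Poly_Mapping.lookup p 0"

definition jacobian :: "('v::finite \<Rightarrow> ('v, 'a::comm_ring_1) mpoly) \<Rightarrow> ('v, 'a) mpoly ^ 'v ^ 'v" where
  "jacobian G = (\<chi> i j. pdiff j (G i))"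

definition keller_map :: "('v::finite \<Rightarrow> ('v, 'a::field) mpoly) \<Rightarrow> bool" where
  "keller_map G \<longleftrightarrow> (\<exists>c. c \<noteq> 0 \<and> det (jacobian G) = mconst c)"

end

theory Submission
  imports Defs "HOL-Computational_Algebra.Polynomial"
begin

text \<open>Write \<open>l\<close> for the linear part of \<open>G i\<close>. As \<open>g(0) = 0\<close> and \<open>deg g < d\<close>, comparing homogeneous parts
  gives that \<open>l\<close> divides \<open>g\<close>, so \<open>G i = c + l h\<close>. Reducing \<open>det JG\<close> modulo \<open>l\<close> shows that \<open>h\<close> is a unit
  modulo \<open>l\<close>, that is, a constant \<open>b\<close>. If \<open>h = b + l^m q\<close> with \<open>m \<ge> 1\<close>, symmetry turns \<open>\<partial>\<^sub>i JG\<close> into the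
  Hessian of \<open>G i\<close>, which modulo \<open>l^m\<close> is the rank one matrix \<open>s a a\<^sup>T\<close> with \<open>a = \<nabla>l\<close> and
  \<open>s = m (m + 1) l^(m-1) q\<close>, while the \<open>i\<close>-th row of \<open>JG\<close> is \<open>b a\<close>. Hence
  \<open>0 = b \<partial>\<^sub>i det JG \<equiv> s a\<^sub>i det JG\<close> modulo \<open>l^m\<close>, so \<open>l\<close> divides \<open>q\<close>. Thus every power of \<open>l\<close> divides
  \<open>h - b\<close>, and \<open>h = b\<close>.\<close>

section \<open>Multivariate polynomials\<close>

definition mvar :: "'v \<Rightarrow> ('v, 'a::{zero,one}) mpoly" where
  "mvar v = Poly_Mapping.single (Poly_Mapping.single v 1) 1"

lemma poly_mapping_sum_singles:
  fixes p :: "'k \<Rightarrow>\<^sub>0 'b::comm_monoid_add"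
  shows "p = (\<Sum>m\<in>Poly_Mapping.keys p. Poly_Mapping.single m (Poly_Mapping.lookup p m))"
  by (rule poly_mapping_eqI)
    (simp add: lookup_sum lookup_single when_def in_keys_iff)

text \<open>Every element is a finite sum of terms, so identities that are additive in each argument
  are reduced to single terms. The zero case is a term with coefficient 0.\<close>

lemma poly_mapping_induct_add [case_names single add]:
  fixes p :: "'k \<Rightarrow>\<^sub>0 'b::comm_monoid_add"
  assumes single: "\<And>m a. P (Poly_Mapping.single m a)"
    and add: "\<And>p q. P p \<Longrightarrow> P q \<Longrightarrow> P (p + q)"
  shows "P p"
proof -
  have P0: "P 0" using single[of undefined 0] by simp
  have "P (\<Sum>m\<in>A. Poly_Mapping.single m (f m))" if "finite A" for A and f :: "'k \<Rightarrow> 'b"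
    using that by induction (auto intro: P0 single add)
  then show ?thesis
    by (subst poly_mapping_sum_singles) simp
qed

lemma mconst_0 [simp]: "mconst 0 = 0"
  by (simp add: mconst_def)

lemma mconst_1 [simp]: "mconst 1 = 1"
  by (simp add: mconst_def)

lemma mconst_add: "mconst (a + b) = mconst a + mconst b"
  by (simp add: mconst_def single_add)

lemma mconst_mult: "mconst (a * b) = mconst a * mconst (b :: 'a::semiring_0)"
  by (simp add: mconst_def mult_single)

lemma mconst_of_nat: "mconst (of_nat n) = (of_nat n :: ('v, 'a::semiring_1) mpoly)"
  by (simp add: mconst_def)

lemma mconst_eq_0_iff [simp]: "mconst a = 0 \<longleftrightarrow> a = 0"
  by (metis lookup_single_eq lookup_zero mconst_0 mconst_def)

lemma mconst_dvd_cancel: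
  fixes z q :: "('v, 'a::field) mpoly"
  assumes "u \<noteq> 0" "z dvd mconst u * q"
  shows "z dvd q"
proof -
  have "mconst (inverse u) * (mconst u * q) = q"
    using assms(1) by (simp flip: mconst_mult mult.assoc)
  then show ?thesis
    using assms(2) by (metis dvd_mult)
qed

section \<open>Degrees of monomials and homogeneous parts\<close>

lemma mon_deg_sum: "mon_deg (m :: 'v::finite \<Rightarrow>\<^sub>0 nat) = (\<Sum>v\<in>UNIV. Poly_Mapping.lookup m v)"
  unfolding mon_deg_def by (rule sum.mono_neutral_left) (auto simp: in_keys_iff)

lemma mon_deg_add: "mon_deg (m + n) = mon_deg m + mon_deg (n :: 'v::finite \<Rightarrow>\<^sub>0 nat)"
  by (simp add: mon_deg_sum lookup_add sum.distrib)

lemma mon_deg_single [simp]: "mon_deg (Poly_Mapping.single v n) = n"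
  by (simp add: mon_deg_def)

lemma mon_deg_0 [simp]: "mon_deg 0 = 0"
  by (simp add: mon_deg_def)

lemma mon_deg_eq_0_iff [simp]: "mon_deg (m :: 'v::finite \<Rightarrow>\<^sub>0 nat) = 0 \<longleftrightarrow> m = 0"
  by (auto simp: mon_deg_sum intro: poly_mapping_eqI)

lemma mon_deg_eq_1E:
  assumes "mon_deg (m :: 'v::finite \<Rightarrow>\<^sub>0 nat) = 1"
  obtains v where "m = Poly_Mapping.single v 1"
proof -
  from assms obtain v where v: "Poly_Mapping.lookup m v \<noteq> 0"
    by (force simp: mon_deg_sum)
  define m' where "m' = m - Poly_Mapping.single v 1"
  have m: "m = m' + Poly_Mapping.single v 1"
    by (rule poly_mapping_eqI)
      (use v in \<open>auto simp: m'_def lookup_add lookup_minus lookup_single when_def\<close>)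
  with assms have "mon_deg m' = 0"
    by (simp add: mon_deg_add)
  with m that show ?thesis
    by simp
qed

lemma lookup_hom_part:
  "Poly_Mapping.lookup (hom_part k p) m = (if mon_deg m = k then Poly_Mapping.lookup p m else 0)"
  by (auto simp: hom_part_def lookup_sum lookup_single when_def in_keys_iff)

lemma hom_part_add: "hom_part k (p + q) = hom_part k p + hom_part k q"
  by (rule poly_mapping_eqI) (simp add: lookup_hom_part lookup_add)

lemma hom_part_diff: "hom_part k (p - q) = hom_part k p - hom_part k (q :: ('v, 'a::ab_group_add) mpoly)"
  by (rule poly_mapping_eqI) (simp add: lookup_hom_part lookup_minus)

lemma hom_part_single:
  "hom_part k (Poly_Mapping.single m a) = (if mon_deg m = k then Poly_Mapping.single m a else 0)"
  by (rule poly_mapping_eqI) (auto simp: lookup_hom_part lookup_single when_def)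

lemma hom_part_mconst: "hom_part k (mconst a) = (if k = 0 then mconst a else 0)"
  by (simp add: mconst_def hom_part_single)

lemma hom_part_0: "hom_part 0 p = mconst (eval_zero (p :: ('v::finite, 'a::comm_monoid_add) mpoly))"
  by (rule poly_mapping_eqI)
    (auto simp: lookup_hom_part mconst_def eval_zero_def lookup_single when_def)

text \<open>Both sides are additive in \<open>p\<close> and in \<open>q\<close>, and for two terms
  only the index \<open>j = mon_deg m\<close> survives.\<close>

lemma hom_part_mult:
  fixes p q :: "('v::finite, 'a::comm_semiring_0) mpoly"
  shows "hom_part k (p * q) = (\<Sum>j\<le>k. hom_part j p * hom_part (k - j) q)"
proof (induction p rule: poly_mapping_induct_add)
  case (single m a)
  show ?case
  proof (induction q rule: poly_mapping_induct_add)
    case (single n b)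
    have "(\<Sum>j\<le>k. hom_part j (Poly_Mapping.single m a) * hom_part (k - j) (Poly_Mapping.single n b)) =
      (\<Sum>j\<le>k. if mon_deg m = j then
          Poly_Mapping.single m a * hom_part (k - j) (Poly_Mapping.single n b) else 0)"
      by (intro sum.cong) (auto simp: hom_part_single)
    then show ?case
      by (auto simp: hom_part_single mult_single mon_deg_add)
  next
    case (add p q)
    then show ?case
      by (simp add: hom_part_add algebra_simps sum.distrib)
  qed
next
  case (add p q)
  then show ?case
    by (simp add: hom_part_add algebra_simps sum.distrib)
qed

lemma hom_part_eq_0: "total_deg p < k \<Longrightarrow> hom_part k p = 0"
proof (rule poly_mapping_eqI)
  fix m assume k: "total_deg p < k"
  have "mon_deg m \<le> total_deg p" if "m \<in> Poly_Mapping.keys p"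
    unfolding total_deg_def using that by (intro Max_ge) auto
  with k show "Poly_Mapping.lookup (hom_part k p) m = Poly_Mapping.lookup 0 m"
    by (cases "m \<in> Poly_Mapping.keys p") (auto simp: lookup_hom_part in_keys_iff)
qed

lemma sum_hom_part:
  assumes "total_deg p < d"
  shows "(\<Sum>k<d. hom_part k p) = p"
proof (rule poly_mapping_eqI)
  fix m
  have "Poly_Mapping.lookup p m = 0" if "\<not> mon_deg m < d"
    using hom_part_eq_0[of p "mon_deg m"] lookup_hom_part[of "mon_deg m" p m] assms that by simp
  then show "Poly_Mapping.lookup (\<Sum>k<d. hom_part k p) m = Poly_Mapping.lookup p m"
    by (auto simp: lookup_sum lookup_hom_part)
qed

lemma single_1_eq_iff: "Poly_Mapping.single v (1::nat) = Poly_Mapping.single w 1 \<longleftrightarrow> v = w"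
  by (metis lookup_single_eq lookup_single_not_eq zero_neq_one)

lemma hom_part_1_expand:
  fixes p :: "('v::finite, 'a::comm_semiring_1) mpoly"
  shows "hom_part 1 p =
    (\<Sum>v\<in>UNIV. mconst (Poly_Mapping.lookup p (Poly_Mapping.single v 1)) * mvar v)"
proof (rule poly_mapping_eqI)
  fix m
  have "Poly_Mapping.lookup (\<Sum>v\<in>UNIV. mconst (Poly_Mapping.lookup p (Poly_Mapping.single v 1)) * mvar v) m
    = (\<Sum>v\<in>UNIV. if Poly_Mapping.single v 1 = m then Poly_Mapping.lookup p m else 0)"
    by (auto simp: lookup_sum mconst_def mvar_def mult_single lookup_single when_def intro!: sum.cong)
  also have "\<dots> = (if mon_deg m = 1 then Poly_Mapping.lookup p m else 0)"
  proof (cases "mon_deg m = 1")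
    case True
    then obtain v where "m = Poly_Mapping.single v 1"
      by (rule mon_deg_eq_1E)
    then show ?thesis by (simp add: single_1_eq_iff del: One_nat_def)
  qed (auto intro!: sum.neutral)
  finally show "Poly_Mapping.lookup (hom_part 1 p) m = Poly_Mapping.lookup
      (\<Sum>v\<in>UNIV. mconst (Poly_Mapping.lookup p (Poly_Mapping.single v 1)) * mvar v) m"
    by (simp add: lookup_hom_part)
qed

lemma total_deg_mconst_add_linear:
  fixes p :: "('v::finite, 'a::comm_monoid_add) mpoly"
  assumes "p = mconst c + hom_part 1 p" "hom_part 1 p \<noteq> 0"
  shows "total_deg p = 1"
proof -
  have "mon_deg m \<le> 1" if "m \<in> Poly_Mapping.keys p" for m
  proof (rule ccontr)
    assume "\<not> mon_deg m \<le> 1"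
    then have "m \<noteq> 0" "mon_deg m \<noteq> 1" by auto
    then have "Poly_Mapping.lookup (mconst c + hom_part 1 p) m = 0"
      by (simp add: lookup_add mconst_def lookup_single lookup_hom_part when_def)
    with assms(1) that show False
      by (simp add: in_keys_iff)
  qed
  then have "total_deg p \<le> 1"
    unfolding total_deg_def by (subst Max_le_iff) auto
  moreover have "total_deg p \<ge> 1"
    using hom_part_eq_0[of p 1] assms(2) by linarith
  ultimately show ?thesis by simp
qed

text \<open>Stripping off the unit \<open>u(0)\<close> degree by degree shows that \<open>l\<close> divides the low-degree parts of
  \<open>g\<close> as soon as it divides those of \<open>g u\<close>.\<close>

lemma dvd_hom_part_factor:
  fixes g u l :: "('v::finite, 'a::field) mpoly"
  assumes "eval_zero g = 0" "eval_zero u \<noteq> 0"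
    and "\<And>k. 1 \<le> k \<Longrightarrow> k < d \<Longrightarrow> l dvd hom_part k (g * u)"
  shows "k < d \<Longrightarrow> l dvd hom_part k g"
proof (induction k rule: less_induct)
  case (less k)
  show ?case
  proof (cases "k = 0")
    case True
    then show ?thesis using assms(1) by (simp add: hom_part_0)
  next
    case False
    have "hom_part k (g * u) = (\<Sum>j<k. hom_part j g * hom_part (k - j) u) + hom_part k g * hom_part 0 u"
      by (simp add: hom_part_mult flip: lessThan_Suc_atMost)
    moreover have "l dvd (\<Sum>j<k. hom_part j g * hom_part (k - j) u)"
      using less by (intro dvd_sum dvd_mult2) auto
    moreover have "l dvd hom_part k (g * u)"
      using assms(3) less.prems False by simp
    ultimately have "l dvd hom_part k g * hom_part 0 u"
      by (simp add: dvd_add_right_iff)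
    then show ?thesis
      using mconst_dvd_cancel[OF assms(2)] by (simp add: hom_part_0 mult.commute)
  qed
qed

text \<open>Without a constant term, \<open>l\<close> has order at least 1, so
  \<open>l ^ n * q\<close> has order at least \<open>n\<close>.\<close>

lemma hom_part_power_mult_eq_0:
  fixes l q :: "('v::finite, 'a::comm_ring_1) mpoly"
  assumes "eval_zero l = 0"
  shows "k < n \<Longrightarrow> hom_part k (l ^ n * q) = 0"
proof (induction n arbitrary: k)
  case (Suc n)
  have "hom_part j l * hom_part (k - j) (l ^ n * q) = 0" if "j \<le> k" for j
    using Suc assms that by (cases "j = 0") (auto simp: hom_part_0)
  then show ?case
    by (simp add: mult.assoc hom_part_mult)
qed simp

text \<open>The power \<open>l ^ Suc k\<close> already forces the part of degree \<open>k\<close> to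
  vanish, and a polynomial with no nonzero part is zero.\<close>

lemma eq_0_if_power_dvd:
  fixes l p :: "('v::finite, 'a::comm_ring_1) mpoly"
  assumes "eval_zero l = 0" "\<And>n. l ^ Suc n dvd p"
  shows "p = 0"
proof -
  have "hom_part k p = 0" for k
    using assms(2)[of k] hom_part_power_mult_eq_0[OF assms(1), of k "Suc k"] by (auto simp: dvd_def)
  then show ?thesis
    using sum_hom_part[of p "Suc (total_deg p)"] by simp
qed

section \<open>Partial derivatives\<close>

text \<open>Coefficientwise, the truncated subtraction in \<open>pdiff\<close> disappears: where it
  truncates, the factor \<open>of_nat 0\<close> kills the term.\<close>

lemma lookup_pdiff:
  "Poly_Mapping.lookup (pdiff v p) m =
    of_nat (Suc (Poly_Mapping.lookup m v)) * Poly_Mapping.lookup p (m + Poly_Mapping.single v 1)"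
proof -
  let ?n = "m + Poly_Mapping.single v 1"
  have eq: "k - Poly_Mapping.single v 1 = m \<longleftrightarrow> k = ?n" if "Poly_Mapping.lookup k v \<noteq> 0" for k
  proof
    assume "k - Poly_Mapping.single v 1 = m"
    then show "k = ?n"
      using that by (auto intro!: poly_mapping_eqI simp: lookup_add lookup_minus lookup_single when_def)
  qed simp
  have "Poly_Mapping.lookup (pdiff v p) m = (\<Sum>k\<in>Poly_Mapping.keys p.
      if k = ?n then of_nat (Poly_Mapping.lookup k v) * Poly_Mapping.lookup p k else 0)"
    unfolding pdiff_def lookup_sum
  proof (intro sum.cong refl)
    fix k
    show "Poly_Mapping.lookup (Poly_Mapping.single (k - Poly_Mapping.single v 1)
        (of_nat (Poly_Mapping.lookup k v) * Poly_Mapping.lookup p k)) m =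
      (if k = ?n then of_nat (Poly_Mapping.lookup k v) * Poly_Mapping.lookup p k else 0)"
      using eq[of k] by (cases "Poly_Mapping.lookup k v = 0") (auto simp: lookup_single when_def)
  qed
  then show ?thesis
    by (auto simp: in_keys_iff lookup_add)
qed

lemma pdiff_add: "pdiff v (p + q) = pdiff v p + pdiff v q"
  by (rule poly_mapping_eqI) (simp add: lookup_pdiff lookup_add algebra_simps)

lemma pdiff_mconst [simp]: "pdiff v (mconst a) = 0"
  by (simp add: pdiff_def mconst_def)

lemma pdiff_hom_part_1:
  "pdiff v (hom_part 1 p) = mconst (Poly_Mapping.lookup p (Poly_Mapping.single v 1))"
  for p :: "('v::finite, 'a::comm_ring_1) mpoly"
  by (rule poly_mapping_eqI)
    (auto simp: lookup_pdiff lookup_hom_part mon_deg_add mconst_def lookup_single when_def)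

lemma pdiff_commute: "pdiff v (pdiff w p) = pdiff w (pdiff v p)"
  by (cases "v = w")
    (auto intro!: poly_mapping_eqI simp: lookup_pdiff lookup_add lookup_single when_def algebra_simps)

lemma pdiff_single:
  "pdiff v (Poly_Mapping.single m a) =
    Poly_Mapping.single (m - Poly_Mapping.single v 1) (of_nat (Poly_Mapping.lookup m v) * a)"
  by (simp add: pdiff_def)

lemma monomial_diff_var_add:
  assumes "Poly_Mapping.lookup m v \<noteq> 0"
  shows "m - Poly_Mapping.single v 1 + n = m + n - Poly_Mapping.single v (1::nat)"
  using assms by (auto intro!: poly_mapping_eqI simp: lookup_add lookup_minus lookup_single when_def)

lemma pdiff_mult:
  fixes p q :: "('v, 'a::comm_ring_1) mpoly"
  shows "pdiff v (p * q) = pdiff v p * q + p * pdiff v q"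
proof (induction p rule: poly_mapping_induct_add)
  case (single m a)
  show ?case
  proof (induction q rule: poly_mapping_induct_add)
    case (single n b)
    show ?case
      \<comment> \<open>The subtraction is moved past the other exponent vector where the variable
        occurs; where it does not, the coefficient is zero.\<close>
      using monomial_diff_var_add[of m v n] monomial_diff_var_add[of n v m]
      by (cases "Poly_Mapping.lookup m v = 0"; cases "Poly_Mapping.lookup n v = 0")
        (simp_all add: pdiff_single mult_single lookup_add add.commute algebra_simps flip: single_add)
  next
    case (add p q)
    then show ?case by (simp add: pdiff_add algebra_simps)
  qed
next
  case (add p q)
  then show ?case by (simp add: pdiff_add algebra_simps)
qed

lemma pdiff_power_Suc:
  "pdiff v (p ^ Suc n) = of_nat (Suc n) * p ^ n * pdiff v (p :: ('v, 'a::comm_ring_1) mpoly)"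
  by (induction n) (simp_all add: pdiff_mult algebra_simps)

section \<open>Substitutions\<close>

text \<open>The evaluation map sending coefficients through \<open>f\<close> and variables to
  \<open>x\<close>. A general \<open>f\<close> covers both substitutions within the ring, with
  \<open>f = mconst\<close>, and maps to univariate polynomials.\<close>

definition insertion :: "('a \<Rightarrow> 'b) \<Rightarrow> ('v \<Rightarrow> 'b) \<Rightarrow> ('v::finite, 'a::comm_semiring_1) mpoly \<Rightarrow> 'b::comm_semiring_1"
  where "insertion f x p = (\<Sum>m\<in>Poly_Mapping.keys p.
    f (Poly_Mapping.lookup p m) * (\<Prod>v\<in>UNIV. x v ^ Poly_Mapping.lookup m v))"

locale semiring_hom_1 =
  fixes f :: "'a::comm_semiring_1 \<Rightarrow> 'b::comm_semiring_1"
  assumes f_0: "f 0 = 0" and f_1: "f 1 = 1"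
    and f_add: "f (a + b) = f a + f b" and f_mult: "f (a * b) = f a * f b"
begin

lemma insertion_single:
  "insertion f x (Poly_Mapping.single m a) = f a * (\<Prod>v\<in>UNIV. x v ^ Poly_Mapping.lookup m v)"
  by (simp add: insertion_def f_0)

lemma insertion_zero: "insertion f x 0 = 0"
  by (simp add: insertion_def)

lemma insertion_add: "insertion f x (p + q) = insertion f x p + insertion f x q"
  unfolding insertion_def
  by (rule setsum_keys_plus_distrib) (simp_all add: f_0 f_add algebra_simps)

lemma insertion_sum: "insertion f x (sum h A) = (\<Sum>a\<in>A. insertion f x (h a))"
  by (induction A rule: infinite_finite_induct) (simp_all add: insertion_zero insertion_add)

lemma insertion_mult: "insertion f x (p * q) = insertion f x p * insertion f x q"
proof (induction p rule: poly_mapping_induct_add)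
  case (single m a)
  show ?case
    by (induction q rule: poly_mapping_induct_add)
      (simp_all add: mult_single insertion_single insertion_add f_mult lookup_add power_add
        prod.distrib algebra_simps)
qed (simp add: insertion_add algebra_simps)

lemma insertion_mconst: "insertion f x (mconst a) = f a"
  by (simp add: mconst_def insertion_single)

lemma insertion_mvar: "insertion f x (mvar v) = x v"
proof -
  have "(\<Prod>w\<in>UNIV. x w ^ Poly_Mapping.lookup (Poly_Mapping.single v (1::nat)) w) =
    (\<Prod>w\<in>UNIV. if v = w then x w else 1)"
    by (intro prod.cong) (auto simp: lookup_single when_def)
  then show ?thesis
    by (simp add: mvar_def insertion_single f_1)
qed

end

section \<open>Congruences under substitution\<close>

lemma single_eq_prod_mvar:
  fixes m :: "'v::finite \<Rightarrow>\<^sub>0 nat" and a :: "'a::comm_semiring_1"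
  shows "Poly_Mapping.single m a = mconst a * (\<Prod>v\<in>UNIV. mvar v ^ Poly_Mapping.lookup m v)"
proof -
  have pow: "mvar v ^ n = Poly_Mapping.single (Poly_Mapping.single v n) (1::'a)" for v :: 'v and n
    by (induction n) (simp_all add: mvar_def mult_single flip: single_add)
  have "(\<Prod>v\<in>A. Poly_Mapping.single (h v) (1::'a)) = Poly_Mapping.single (\<Sum>v\<in>A. h v) 1"
    if "finite A" for A :: "'v set" and h :: "'v \<Rightarrow> 'v \<Rightarrow>\<^sub>0 nat"
    using that by induction (simp_all add: mult_single)
  moreover have "(\<Sum>v\<in>UNIV. Poly_Mapping.single v (Poly_Mapping.lookup m v)) = m"
    by (rule poly_mapping_eqI) (simp add: lookup_sum lookup_single when_def)
  ultimately show ?thesis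
    by (simp add: pow mconst_def mult_single)
qed

text \<open>Telescoping: the factors are exchanged one at a time, each exchange costing a multiple
  of \<open>z\<close>.\<close>

lemma dvd_prod_diff:
  fixes f g :: "'i \<Rightarrow> 'r::comm_ring_1"
  assumes "\<And>i. i \<in> A \<Longrightarrow> z dvd f i - g i"
  shows "z dvd prod f A - prod g A"
  using assms
proof (induction A rule: infinite_finite_induct)
  case (insert a A)
  have "prod f (insert a A) - prod g (insert a A) =
    (f a - g a) * prod f A + g a * (prod f A - prod g A)"
    using insert by (simp add: algebra_simps)
  with insert show ?case by simp
qed simp_all

lemma dvd_insertion_diff:
  fixes p z :: "('v::finite, 'a::comm_ring_1) mpoly"
  assumes "\<And>v. z dvd x v - mvar v"
  shows "z dvd insertion mconst x p - p"
proof -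
  interpret semiring_hom_1 "mconst :: 'a \<Rightarrow> ('v, 'a) mpoly"
    by standard (simp_all add: mconst_add mconst_mult)
  show ?thesis
  proof (induction p rule: poly_mapping_induct_add)
    case (single m a)
    \<comment> \<open>A power is a product of equal factors, so the congruence of products
      applies.\<close>
    have "z dvd x v ^ n - mvar v ^ n" for v n
      using dvd_prod_diff[of "{..<n}" z "\<lambda>_. x v" "\<lambda>_. mvar v"] assms by simp
    then have "z dvd (\<Prod>v\<in>UNIV. x v ^ Poly_Mapping.lookup m v) - (\<Prod>v\<in>UNIV. mvar v ^ Poly_Mapping.lookup m v)"
      by (intro dvd_prod_diff)
    then show ?case
      by (simp only: insertion_single) (simp add: single_eq_prod_mvar[of m a] flip: right_diff_distrib)
  next
    case (add p q)
    then show ?case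
      by (simp add: insertion_add add_diff_add)
  qed
qed

section \<open>Kronecker substitution\<close>

text \<open>Positional notation in base \<open>B\<close>: the new variable gets a weight above every
  old weighted sum on \<open>S\<close>, so division by \<open>B\<close> recovers its exponent and
  leaves the old sum as remainder.\<close>

lemma ex_separating_weights_on:
  fixes S :: "('v \<Rightarrow>\<^sub>0 nat) set"
  assumes "finite V" "finite S"
  shows "\<exists>w. (\<forall>v. w v \<ge> (1::nat)) \<and> (\<forall>m\<in>S. \<forall>n\<in>S.
    (\<Sum>v\<in>V. w v * Poly_Mapping.lookup m v) = (\<Sum>v\<in>V. w v * Poly_Mapping.lookup n v) \<longrightarrow>
    (\<forall>v\<in>V. Poly_Mapping.lookup m v = Poly_Mapping.lookup n v))"
  using assms(1)
proof induction
  case empty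
  show ?case by (intro exI[of _ "\<lambda>_. 1"]) simp
next
  case (insert a V)
  then obtain w where w1: "\<And>v. w v \<ge> 1" and w: "\<And>m n. m \<in> S \<Longrightarrow> n \<in> S \<Longrightarrow>
    (\<Sum>v\<in>V. w v * Poly_Mapping.lookup m v) = (\<Sum>v\<in>V. w v * Poly_Mapping.lookup n v) \<Longrightarrow>
    (\<forall>v\<in>V. Poly_Mapping.lookup m v = Poly_Mapping.lookup n v)"
    by blast
  define s where "s m = (\<Sum>v\<in>V. w v * Poly_Mapping.lookup m v)" for m
  \<comment> \<open>\<open>Suc\<close> makes the bound strict and keeps the new weight
    positive.\<close>
  define B where "B = Suc (\<Sum>m\<in>S. s m)"
  have B: "s m < B" if "m \<in> S" for m
    using member_le_sum[of m S s] that assms(2) by (simp add: B_def)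
  define w' where "w' = w(a := B)"
  have sum': "(\<Sum>v\<in>insert a V. w' v * Poly_Mapping.lookup m v) = B * Poly_Mapping.lookup m a + s m" for m
    using insert.hyps by (auto simp: w'_def s_def intro!: sum.cong)
  have "\<forall>v. w' v \<ge> 1"
    using w1 by (simp add: w'_def B_def)
  moreover have "\<forall>v\<in>insert a V. Poly_Mapping.lookup m v = Poly_Mapping.lookup n v"
    if S: "m \<in> S" "n \<in> S"
      and eq: "B * Poly_Mapping.lookup m a + s m = B * Poly_Mapping.lookup n a + s n" for m n
  proof -
    have div: "(B * k + r) div B = k" if "r < B" for k r
      using that by simp
    have a: "Poly_Mapping.lookup m a = Poly_Mapping.lookup n a"
      using div[OF B[OF S(1)]] div[OF B[OF S(2)]] eq by metis
    with eq have "s m = s n" by simp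
    with w[OF S] a show ?thesis by (simp add: s_def)
  qed
  ultimately show ?case
    unfolding sum'[symmetric] by blast
qed

text \<open>With weights separating the monomials of \<open>p\<close>, no two terms of \<open>p\<close> merge under the substitution
  \<open>x\<^sub>v := t ^ w v\<close>. This reduces the absence of zero divisors and the determination of the units to
  univariate polynomials; the library instance for \<open>idom\<close> would need a linear order on the variables.\<close>

definition kronecker :: "('v \<Rightarrow> nat) \<Rightarrow> ('v::finite, 'a::comm_ring_1) mpoly \<Rightarrow> 'a poly" where
  "kronecker w = insertion (\<lambda>a. [:a:]) (\<lambda>v. monom 1 (w v))"

interpretation pconst: semiring_hom_1 "\<lambda>a :: 'a::comm_ring_1. [:a:]"
  by standard (simp_all add: one_pCons)

definition weight :: "('v \<Rightarrow> nat) \<Rightarrow> ('v::finite \<Rightarrow>\<^sub>0 nat) \<Rightarrow> nat" where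
  "weight w m = (\<Sum>v\<in>UNIV. w v * Poly_Mapping.lookup m v)"

lemma coeff_kronecker:
  assumes "inj_on (weight w) (Poly_Mapping.keys p)" "m \<in> Poly_Mapping.keys p"
  shows "coeff (kronecker w p) (weight w m) = Poly_Mapping.lookup p m"
proof -
  have "(\<Prod>v\<in>UNIV. monom (1::'b) (w v) ^ Poly_Mapping.lookup n v) = monom 1 (weight w n)" for n
  proof -
    have "(\<Prod>v\<in>A. monom (1::'b) (w v) ^ Poly_Mapping.lookup n v) =
      monom 1 (\<Sum>v\<in>A. w v * Poly_Mapping.lookup n v)" if "finite A" for A
      using that by induction (simp_all add: monom_power mult_monom)
    then show ?thesis by (simp add: weight_def)
  qed
  then have "coeff (kronecker w p) (weight w m) = (\<Sum>n\<in>Poly_Mapping.keys p.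
      if weight w n = weight w m then Poly_Mapping.lookup p n else 0)"
    by (simp add: kronecker_def insertion_def coeff_sum smult_monom)
  also have "\<dots> = (\<Sum>n\<in>Poly_Mapping.keys p. if n = m then Poly_Mapping.lookup p n else 0)"
    using assms by (intro sum.cong) (auto dest: inj_onD)
  finally show ?thesis
    using assms(2) by simp
qed

lemma ex_separating_weights:
  assumes "finite S"
  obtains w :: "'v::finite \<Rightarrow> nat" where "\<And>v. w v \<ge> 1" "inj_on (weight w) S"
proof -
  obtain w :: "'v \<Rightarrow> nat" where w: "\<forall>v. w v \<ge> 1" "\<forall>m\<in>S. \<forall>n\<in>S. weight w m = weight w n \<longrightarrow>
      (\<forall>v. Poly_Mapping.lookup m v = Poly_Mapping.lookup n v)"
    using ex_separating_weights_on[of "UNIV :: 'v set", OF finite assms] unfolding weight_def by auto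
  show ?thesis
    by (rule that[of w]) (use w in \<open>auto intro!: inj_onI poly_mapping_eqI\<close>)
qed

lemma mpoly_mult_eq_0:
  fixes p q :: "('v::finite, 'a::idom) mpoly"
  assumes "p * q = 0"
  shows "p = 0 \<or> q = 0"
proof (rule ccontr)
  assume nz: "\<not> (p = 0 \<or> q = 0)"
  \<comment> \<open>Separating the monomials of both factors at once keeps both images
    nonzero.\<close>
  obtain w :: "'v \<Rightarrow> nat" where w: "inj_on (weight w) (Poly_Mapping.keys p \<union> Poly_Mapping.keys q)"
    using ex_separating_weights[of "Poly_Mapping.keys p \<union> Poly_Mapping.keys q"] by auto
  have "kronecker w r \<noteq> 0" if r: "r \<noteq> 0" "inj_on (weight w) (Poly_Mapping.keys r)" for r :: "('v, 'a) mpoly"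
  proof -
    obtain m where "Poly_Mapping.lookup r m \<noteq> 0"
      using r(1) by (auto simp: poly_mapping_eq_iff fun_eq_iff)
    then show ?thesis
      using coeff_kronecker[OF r(2), of m] by (auto simp: in_keys_iff)
  qed
  with w nz have "kronecker w p * kronecker w q \<noteq> 0"
    by (simp add: inj_on_Un)
  moreover have "kronecker w p * kronecker w q = 0"
    using assms by (simp add: kronecker_def pconst.insertion_zero flip: pconst.insertion_mult)
  ultimately show False by simp
qed

lemma mpoly_unit_is_mconst:
  fixes p q :: "('v::finite, 'a::idom) mpoly"
  assumes "p * q = mconst a" "a \<noteq> 0"
  shows "\<exists>b. p = mconst b"
proof -
  obtain w :: "'v \<Rightarrow> nat" where w1: "\<And>v. w v \<ge> 1" and w: "inj_on (weight w) (Poly_Mapping.keys p)"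
    using ex_separating_weights[of "Poly_Mapping.keys p"] by auto
  have eq: "kronecker w p * kronecker w q = [:a:]"
    using assms(1) by (simp add: kronecker_def pconst.insertion_mconst flip: pconst.insertion_mult)
  with assms(2) have "kronecker w p \<noteq> 0" "kronecker w q \<noteq> 0" by auto
  with eq have deg: "degree (kronecker w p) = 0"
    by (metis add_is_0 degree_mult_eq degree_pCons_0)
  \<comment> \<open>Positive weights turn any monomial other than 1 into a positive power, which a
    constant image excludes.\<close>
  have "m = 0" if m: "m \<in> Poly_Mapping.keys p" for m
  proof (rule ccontr)
    assume "m \<noteq> 0"
    then obtain v where "Poly_Mapping.lookup m v \<noteq> 0"
      by (auto simp: poly_mapping_eq_iff fun_eq_iff)
    with w1[of v] have "weight w m \<noteq> 0"
      by (auto simp: weight_def intro!: exI[of _ v])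
    with deg have "coeff (kronecker w p) (weight w m) = 0"
      by (simp add: coeff_eq_0)
    with coeff_kronecker[OF w m] m show False
      by (simp add: in_keys_iff)
  qed
  then have "p = mconst (Poly_Mapping.lookup p 0)"
    by (intro poly_mapping_eqI) (auto simp: mconst_def lookup_single when_def in_keys_iff)
  then show ?thesis ..
qed

section \<open>Determinants over commutative rings\<close>

abbreviation replace_row :: "'n \<Rightarrow> 'r ^ 'n \<Rightarrow> 'r ^ 'n ^ 'n \<Rightarrow> 'r ^ 'n ^ 'n::finite" where
  "replace_row j x A \<equiv> (\<chi> k. if k = j then x else A $ k)"

lemma det_replace_row_smult:
  "det (replace_row j (c *s x) A) = c * det (replace_row j x (A :: 'r::comm_ring_1 ^ 'n ^ 'n))"
  using det_row_mul[of j c "\<lambda>_. x" "\<lambda>k. A $ k"] .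

lemma det_replace_row_self:
  "det (replace_row j (A $ i) A) = (if j = i then det A else (0 :: 'r::comm_ring_1))"
proof (cases "j = i")
  case True
  then have "replace_row j (A $ i) A = A" by (simp add: vec_eq_iff)
  with True show ?thesis by simp
next
  case False
  then show ?thesis
    using det_identical_rows[of j i "replace_row j (A $ i) A"] by (simp add: row_def)
qed

text \<open>The Leibniz formula is a sum of signed products, and products respect
  congruence.\<close>

lemma dvd_det_diff:
  fixes A B :: "'r::comm_ring_1 ^ 'n ^ 'n"
  assumes "\<And>i j. z dvd A $ i $ j - B $ i $ j"
  shows "z dvd det A - det B"
proof -
  have "det A - det B = (\<Sum>p | p permutes (UNIV :: 'n set).
      of_int (sign p) * ((\<Prod>i\<in>UNIV. A $ i $ p i) - (\<Prod>i\<in>UNIV. B $ i $ p i)))"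
    by (simp add: det_def right_diff_distrib sum_subtractf)
  then show ?thesis
    by (simp add: dvd_sum dvd_mult dvd_prod_diff assms)
qed

section \<open>Derivations and determinants\<close>

locale derivation =
  fixes D :: "'r::comm_ring_1 \<Rightarrow> 'r"
  assumes D_add: "D (a + b) = D a + D b"
    and D_mult: "D (a * b) = D a * b + a * D b"
begin

lemma D_0: "D 0 = 0"
  using D_add[of 0 0] by simp

lemma D_1: "D 1 = 0"
  using D_mult[of 1 1] by simp

lemma D_minus: "D (- a) = - D a"
  using D_add[of a "- a"] by (simp add: D_0 eq_neg_iff_add_eq_0 add.commute)

lemma D_sum: "D (sum f A) = (\<Sum>a\<in>A. D (f a))"
  by (induction A rule: infinite_finite_induct) (simp_all add: D_0 D_add)

lemma D_prod:
  "finite A \<Longrightarrow> D (prod f A) = (\<Sum>j\<in>A. \<Prod>i\<in>A. if i = j then D (f i) else f i)"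
proof (induction rule: finite_induct)
  case (insert a A)
  have "(\<Prod>i\<in>A. if i = a then D (f i) else f i) = prod f A"
    using insert.hyps by (intro prod.cong) auto
  moreover have "(\<Sum>j\<in>A. (if a = j then D (f a) else f a) * (\<Prod>i\<in>A. if i = j then D (f i) else f i)) =
    (\<Sum>j\<in>A. f a * (\<Prod>i\<in>A. if i = j then D (f i) else f i))"
    using insert.hyps by (intro sum.cong) auto
  ultimately show ?case
    using insert by (simp add: D_mult sum_distrib_left)
qed (simp add: D_1)

lemma D_det:
  "D (det A) = (\<Sum>j\<in>UNIV. det (replace_row j (\<chi> k. D (A $ j $ k)) (A :: 'r ^ 'n ^ 'n)))"
proof -
  \<comment> \<open>Signs are 1 or -1, so the derivation passes through them.\<close>
  have sgn: "D (of_int (sign p) * x) = of_int (sign p) * D x" for p :: "'n \<Rightarrow> 'n" and x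
    by (cases p rule: sign_cases) (simp_all add: D_minus)
  have "D (det A) = (\<Sum>p | p permutes (UNIV :: 'n set). \<Sum>j\<in>UNIV. of_int (sign p) *
      (\<Prod>i\<in>UNIV. if i = j then D (A $ i $ p i) else A $ i $ p i))"
    by (simp add: det_def D_sum sgn D_prod sum_distrib_left)
  also have "\<dots> = (\<Sum>j\<in>UNIV. \<Sum>p | p permutes (UNIV :: 'n set). of_int (sign p) *
      (\<Prod>i\<in>UNIV. if i = j then D (A $ i $ p i) else A $ i $ p i))"
    by (rule sum.swap)
  also have "\<dots> = (\<Sum>j\<in>UNIV. det (replace_row j (\<chi> k. D (A $ j $ k)) A))"
    unfolding det_def by (intro sum.cong prod.cong arg_cong2[where f = "(*)"] refl) auto
  finally show ?thesis .
qed

text \<open>If, modulo \<open>z\<close>, the matrix \<open>c D A\<close> is the outer product of \<open>t\<close> with the \<open>i\<close>-th row of \<open>A\<close>, then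
  replacing the \<open>j\<close>-th row of \<open>A\<close> by its derivative creates a repeated row unless \<open>j = i\<close>.\<close>

lemma dvd_det_if_rank_one_derivative:
  fixes A :: "'r ^ 'n ^ 'n"
  assumes det: "D (det A) = 0"
    and cong: "\<And>j k. z dvd c * D (A $ j $ k) - t j * A $ i $ k"
  shows "z dvd t i * det A"
proof -
  have "(\<Sum>j\<in>UNIV. det (replace_row j (t j *s A $ i) A)) = t i * det A"
    by (simp add: det_replace_row_smult det_replace_row_self if_distrib[of "(*) _"] cong: if_cong)
  moreover have "(\<Sum>j\<in>UNIV. det (replace_row j (c *s (\<chi> k. D (A $ j $ k))) A)) = c * D (det A)"
    by (simp add: det_replace_row_smult D_det sum_distrib_left)
  \<comment> \<open>The two sums are congruent term by term, and the one with the true derivatives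
    is \<open>c * D (det A) = 0\<close>.\<close>
  moreover have "z dvd (\<Sum>j\<in>UNIV. det (replace_row j (c *s (\<chi> k. D (A $ j $ k))) A)
      - det (replace_row j (t j *s A $ i) A))"
    by (intro dvd_sum dvd_det_diff) (use cong in auto)
  ultimately show ?thesis
    using det by (simp add: sum_subtractf)
qed

end

lemma derivation_pdiff: "derivation (pdiff v :: ('v, 'a::comm_ring_1) mpoly \<Rightarrow> _)"
  by standard (simp_all add: pdiff_add pdiff_mult)

section \<open>Symmetric Keller maps\<close>

text \<open>Solving \<open>l = 0\<close> for the \<open>i\<close>-th variable realizes the quotient by \<open>l\<close> inside the polynomial ring.\<close>

lemma insertion_elim_mvar:
  fixes a :: "'v::finite \<Rightarrow> 'a::field"
  assumes l: "l = (\<Sum>v\<in>UNIV. mconst (a v) * mvar v)" and ai: "a i \<noteq> 0"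
    and x: "x = (\<lambda>v. if v = i then mvar i - mconst (inverse (a i)) * l else mvar v)"
  shows "insertion mconst x l = 0" and "l dvd insertion mconst x p - p"
proof -
  interpret semiring_hom_1 "mconst :: 'a \<Rightarrow> ('v, 'a) mpoly"
    by standard (simp_all add: mconst_add mconst_mult)
  have "insertion mconst x l = (\<Sum>v\<in>UNIV. mconst (a v) * x v)"
    by (subst l) (simp add: insertion_sum insertion_mult insertion_mconst insertion_mvar)
  \<comment> \<open>Only the \<open>i\<close>-th summand changes, and it loses exactly
    \<open>l\<close>.\<close>
  also have "\<dots> = (\<Sum>v\<in>UNIV. mconst (a v) * mvar v - (if v = i then mconst (a i) * mconst (inverse (a i)) * l else 0))"
    by (intro sum.cong) (auto simp: x algebra_simps)
  also have "\<dots> = 0"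
    using ai by (simp add: sum_subtractf l flip: mconst_mult)
  finally show "insertion mconst x l = 0" .
  show "l dvd insertion mconst x p - p"
    by (rule dvd_insertion_diff) (simp add: x)
qed

text \<open>Having degree below \<open>d\<close>, \<open>g\<close> is the sum of its parts in
  degrees below \<open>d\<close>; the linear part of \<open>p\<close> divides each of them once the
  cofactor \<open>u\<close> has a nonzero constant term.\<close>

lemma dvd_linear_if_low_degree_factor:
  fixes g p :: "('v::finite, 'a::field) mpoly"
  assumes lin: "hom_part 1 p \<noteq> 0"
    and divs: "\<forall>k\<in>{1..d-1}. hom_part 1 p dvd hom_part k p"
    and gdvd: "g dvd p - mconst c"
    and gdeg: "total_deg g < d"
    and g0: "eval_zero g = 0"
  shows "hom_part 1 p dvd p - mconst c"
proof -
  obtain u where u: "p - mconst c = g * u"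
    using gdvd by (auto simp: dvd_def)
  have hom: "hom_part k (g * u) = hom_part k p" if "k \<ge> 1" for k
    using that by (simp add: hom_part_diff hom_part_mconst flip: u)
  \<comment> \<open>Two factors without constant term would leave their product without linear
    part.\<close>
  have "eval_zero u \<noteq> 0"
  proof
    assume "eval_zero u = 0"
    then have "hom_part 1 (g * u) = 0"
      using g0 by (simp add: hom_part_mult hom_part_0)
    with hom[of 1] lin show False by simp
  qed
  then have "hom_part 1 p dvd hom_part k g" if "k < d" for k
    using dvd_hom_part_factor[OF g0 _ _ that] divs hom by simp
  then have "hom_part 1 p dvd (\<Sum>k<d. hom_part k g)"
    by (intro dvd_sum) simp
  then show ?thesis
    by (simp add: sum_hom_part gdeg u)
qed

text \<open>Modulo \<open>l\<close>, the \<open>i\<close>-th row of the Jacobian is \<open>h\<close> times a constant vector, so \<open>h\<close> is a unit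
  modulo \<open>l\<close>.\<close>

lemma keller_linear_factor_cofactor_const:
  fixes G :: "'v::finite \<Rightarrow> ('v, 'a::field) mpoly"
  assumes keller: "keller_map G"
    and l: "l = (\<Sum>v\<in>UNIV. mconst (a v) * mvar v)" and ai: "a i \<noteq> 0"
    and dl: "\<And>k. pdiff k l = mconst (a k)"
    and Gi: "G i = mconst c + l * h"
  shows "\<exists>b. l dvd h - mconst b"
proof -
  interpret semiring_hom_1 "mconst :: 'a \<Rightarrow> ('v, 'a) mpoly"
    by standard (simp_all add: mconst_add mconst_mult)
  obtain c0 where c0: "c0 \<noteq> 0" "det (jacobian G) = mconst c0"
    using keller by (auto simp: keller_map_def)
  define x where "x = (\<lambda>v. if v = i then mvar i - mconst (inverse (a i)) * l else mvar v)"
  note x = insertion_elim_mvar[OF l ai x_def]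
  define M where "M = replace_row i (\<chi> k. mconst (a k)) (jacobian G)"
  \<comment> \<open>By the product rule, row \<open>i\<close> of the Jacobian is \<open>h\<close>
    times the gradient of \<open>l\<close> plus \<open>l\<close> times the gradient of
    \<open>h\<close>.\<close>
  have "l dvd det (jacobian G) - det (replace_row i (h *s (\<chi> k. mconst (a k))) (jacobian G))"
    by (rule dvd_det_diff) (auto simp: jacobian_def Gi pdiff_add pdiff_mult dl algebra_simps)
  then have "l dvd mconst c0 - h * det M"
    by (simp add: det_replace_row_smult c0 M_def)
  then obtain t where "mconst c0 = h * det M + l * t"
    by (metis diff_eq_eq dvd_def add.commute)
  \<comment> \<open>The substitution kills \<open>l\<close> and fixes constants, so the congruence
    becomes an equation.\<close>
  then have "insertion mconst x (mconst c0) = insertion mconst x (h * det M + l * t)"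
    by simp
  then have "insertion mconst x h * insertion mconst x (det M) = mconst c0"
    by (simp add: insertion_mconst insertion_add insertion_mult x(1))
  then obtain b where "insertion mconst x h = mconst b"
    using mpoly_unit_is_mconst c0(1) by blast
  with x(2)[of h] have "l dvd - (mconst b - h)"
    by (simp only: dvd_minus_iff)
  then have "l dvd h - mconst b"
    by (simp only: minus_diff_eq)
  then show ?thesis ..
qed

text \<open>With \<open>m = n + 1\<close> and \<open>h - b = l ^ m * q\<close>, it remains to see
  that \<open>l\<close> divides \<open>q\<close>. Characteristic zero makes the factors
  \<open>n + 1\<close> and \<open>n + 2\<close> invertible.\<close>

lemma symmetric_keller_cofactor_step:
  fixes G :: "'v::finite \<Rightarrow> ('v, 'a::field_char_0) mpoly"
  assumes keller: "keller_map G"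
    and sym: "\<And>j k. pdiff k (G j) = pdiff j (G k)"
    and ai: "a i \<noteq> 0" and dl: "\<And>k. pdiff k l = mconst (a k)"
    and Gi: "G i = mconst c + l * h"
    and dvd: "l ^ Suc n dvd h - mconst b"
  shows "l ^ Suc (Suc n) dvd h - mconst b"
proof -
  obtain c0 where c0: "c0 \<noteq> 0" "det (jacobian G) = mconst c0"
    using keller by (auto simp: keller_map_def)
  obtain q where q: "h - mconst b = l ^ Suc n * q"
    using dvd by (auto simp: dvd_def)
  define N where "N = (of_nat (Suc (Suc n)) :: ('v, 'a) mpoly)"
  define s where "s = N * of_nat (Suc n) * l ^ n * q"
  have "G i = mconst c + l * mconst b + l ^ Suc (Suc n) * q"
    using q by (simp add: Gi algebra_simps)
  then have D: "pdiff k (G i) = mconst (a k) * mconst b + N * l ^ Suc n * mconst (a k) * q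
      + l ^ Suc (Suc n) * pdiff k q" for k
    unfolding N_def by (simp only: pdiff_add pdiff_mult pdiff_power_Suc dl pdiff_mconst) (simp add: algebra_simps)
  have DN: "pdiff j N = 0" for j
    by (simp add: N_def flip: mconst_of_nat)
  have DD: "pdiff j (pdiff k (G i)) = mconst (a j) * mconst (a k) * s
      + l ^ Suc n * (N * mconst (a k) * pdiff j q + N * mconst (a j) * pdiff k q + l * pdiff j (pdiff k q))" for j k
    unfolding D s_def
    by (simp only: pdiff_add pdiff_mult pdiff_power_Suc dl pdiff_mconst DN)
      (simp add: N_def algebra_simps)
  interpret derivation "pdiff i :: ('v, 'a) mpoly \<Rightarrow> _"
    by (rule derivation_pdiff)
  \<comment> \<open>Here \<open>c\<close> is \<open>mconst b\<close> and \<open>t j\<close> is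
    \<open>mconst (a j) * s\<close>: scaling the derivative by \<open>b\<close> matches it with
    multiples of the row \<open>b a\<close>, without dividing by \<open>b\<close>.\<close>
  have "l ^ Suc n dvd mconst (a i) * s * det (jacobian G)"
  proof (rule dvd_det_if_rank_one_derivative)
    show "pdiff i (det (jacobian G)) = 0"
      by (simp add: c0)
  next
    fix j k
    \<comment> \<open>Symmetry and commuting derivatives turn the derivative of the Jacobian entry
      into a second derivative of \<open>G i\<close>.\<close>
    have "mconst b * pdiff i (jacobian G $ j $ k) - mconst (a j) * s * jacobian G $ i $ k =
      mconst b * pdiff j (pdiff k (G i)) - mconst (a j) * s * pdiff k (G i)"
      using sym[of i j] pdiff_commute[of i k "G j"] pdiff_commute[of k j "G i"]
      by (simp add: jacobian_def)
    also have "\<dots> = l ^ Suc n * (mconst b * (N * mconst (a k) * pdiff j q + N * mconst (a j) * pdiff k q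
        + l * pdiff j (pdiff k q)) - mconst (a j) * s * (N * mconst (a k) * q + l * pdiff k q))"
      unfolding DD unfolding D by (simp add: algebra_simps)
    finally show "l ^ Suc n dvd mconst b * pdiff i (jacobian G $ j $ k) - mconst (a j) * s * jacobian G $ i $ k"
      by simp
  qed
  then have "l ^ Suc n dvd mconst (a i * of_nat (Suc (Suc n)) * of_nat (Suc n) * c0) * (l ^ n * q)"
    unfolding c0 s_def N_def mconst_mult mconst_of_nat by (simp only: ac_simps)
  then have "l ^ Suc n dvd l ^ n * q"
    by (rule mconst_dvd_cancel[rotated])
      (use ai c0(1) in \<open>simp del: of_nat_Suc\<close>)
  then have "l ^ n * l dvd l ^ n * q"
    by (simp add: mult.commute)
  then obtain t where "l ^ n * (q - l * t) = 0"
    by (auto simp: dvd_def algebra_simps)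
  \<comment> \<open>\<open>l\<close> is nonzero because its \<open>i\<close>-th derivative is, so
    \<open>l ^ n\<close> cancels in a ring without zero divisors.\<close>
  moreover have "l \<noteq> 0"
    using dl[of i] ai by (metis mconst_0 mconst_eq_0_iff pdiff_mconst)
  then have "l ^ m \<noteq> 0" for m
    by (induction m) (auto dest: mpoly_mult_eq_0)
  ultimately have "q = l * t"
    using mpoly_mult_eq_0 by fastforce
  then have "h - mconst b = l ^ Suc (Suc n) * t"
    using q by (simp add: ac_simps)
  then show ?thesis
    by (rule dvdI)
qed

theorem theorem7p3:
  fixes G :: "'v::finite \<Rightarrow> ('v, 'a::field_char_0) mpoly"
    and i :: 'v and d :: nat and c :: 'a and g :: "('v, 'a) mpoly"
  assumes keller: "keller_map G"
    and sym: "\<forall>j k. jacobian G $ j $ k = jacobian G $ k $ j"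
    and dpos: "0 < d"
    and lin: "pdiff i (hom_part 1 (G i)) \<noteq> 0"
    and divs: "\<forall>k\<in>{1..d-1}. hom_part 1 (G i) dvd hom_part k (G i)"
    and gdvd: "g dvd (G i - mconst c)"
    and gdeg: "total_deg g < d"
    and g0: "eval_zero g = 0"
  shows "total_deg (G i) = 1"
proof -
  define l where "l = hom_part 1 (G i)"
  define a where "a v = Poly_Mapping.lookup (G i) (Poly_Mapping.single v 1)" for v
  have l: "l = (\<Sum>v\<in>UNIV. mconst (a v) * mvar v)"
    unfolding l_def a_def by (rule hom_part_1_expand)
  have dl: "pdiff k l = mconst (a k)" for k
    unfolding l_def a_def by (rule pdiff_hom_part_1)
  have ai: "a i \<noteq> 0"
    using lin dl[of i] by (auto simp: l_def)
  have l_nz: "hom_part 1 (G i) \<noteq> 0"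
    using lin by (metis mconst_0 pdiff_mconst)
  obtain h where "G i - mconst c = l * h"
    using dvd_linear_if_low_degree_factor[OF l_nz divs gdvd gdeg g0] by (auto simp: l_def dvd_def)
  then have Gi: "G i = mconst c + l * h"
    by (simp add: algebra_simps)
  obtain b where b: "l dvd h - mconst b"
    using keller_linear_factor_cofactor_const[OF keller l ai dl Gi] by blast
  have sym': "pdiff k (G j) = pdiff j (G k)" for j k
    using sym by (simp add: jacobian_def)
  have "l ^ Suc n dvd h - mconst b" for n
  proof (induction n)
    case (Suc n)
    then show ?case
      by (rule symmetric_keller_cofactor_step[where G = G, OF keller sym' ai dl Gi])
  qed (use b in simp)
  moreover have l0: "eval_zero l = 0"
    by (simp add: l_def eval_zero_def lookup_hom_part)
  ultimately have "h - mconst b = 0"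
    by (intro eq_0_if_power_dvd)
  then have Gi': "G i = mconst c + mconst b * l"
    by (simp add: Gi mult.commute)
  have "hom_part 1 (mconst b * l) = mconst b * hom_part 1 l"
    using l0 by (simp add: hom_part_mult hom_part_mconst hom_part_0)
  moreover have "hom_part 1 l = l"
    unfolding l_def by (rule poly_mapping_eqI) (simp add: lookup_hom_part)
  \<comment> \<open>Comparing linear parts absorbs the constant \<open>b\<close>.\<close>
  ultimately have "l = mconst b * l"
    using arg_cong[OF Gi', of "hom_part 1"]
    by (simp add: hom_part_add hom_part_mconst del: One_nat_def flip: l_def)
  with Gi' have "G i = mconst c + hom_part 1 (G i)"
    by (simp add: l_def)
  then show ?thesis
    using l_nz by (rule total_deg_mconst_add_linear)
qed

end
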